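(* Let $\{W_k : k=1,2,\ldots\}$ be a random process of $N\times N$ symmetric doubly stochastic matrices such that: (1) the $W_k$ are independent and identically distributed; (2) there is a scalar $\delta>0$ such that for every realization $W\in\mathcal W$ and all $i,j$, $W_{ij}>0$ implies $W_{ij}\ge\delta$; (3) for every realization $W\in\mathcal W$ and all $i$, $W_{ii}\ge\delta$. Let $\widetilde\Phi(k,0)=W_kW_{k-1}\cdots W_1-J$. Then $$\lim_{k\to\infty}\frac1k\log\mathbb P\left(\left\|\widetilde\Phi(k,0)\right\|\ge\epsilon\right)=-I\qquad\text{for all }\epsilon\in(0,1],$$ where $$I=\begin{cases}+\infty & \text{if }\Pi^\star(\mathcal G)=\emptyset,\\ |\log p_{\max}| & \text{otherwise,}\end{cases}\qquad p_{\max}=\max_{\mathcal H\in\Pi^\star(\mathcal G)}p_{\mathcal H}.$$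
   Context: $V=\{1,\ldots,N\}$, $J=\frac1N\mathbf 1\mathbf 1^\top$, and $\|\cdot\|$ is the spectral norm. $\mathcal W$ denotes the set of all possible realizations of $W_k$ (so each $W_k$ takes values in $\mathcal W$); doubly stochastic means nonnegative entries with all row and column sums equal to $1$. Convention: $\log 0=-\infty$. For a symmetric doubly stochastic matrix $W$, its induced undirected graph is $G(W)=(V,E(W))$ with $E(W)=\{\{i,j\}: i\neq j,\ W_{ij}>0\}$. Let $\mathcal G=\{G(W):W\in\mathcal W\}$ be the (finite) set of realizable graphs, and $G_t=G(W_t)$, $t=1,2,\ldots$, the induced i.i.d. random graph process with values in $\mathcal G$. For a collection $\mathcal H$ of graphs on $V$, $\Gamma(\mathcal H)=(V,\bigcup_{G\in\mathcal H}E(G))$ is its supergraph. For $\mathcal H\subseteq\mathcal G$, $p_{\mathcal H}=\sum_{H\in\mathcal H}\mathbb P(G_t=H)$. A nonempty collection $\mathcal H\subseteq\mathcal G$ is a disconnected collection of $\mathcal G$ if $\Gamma(\mathcal H)$ is disconnected. It is a maximal disconnected collection if it is a disconnected collection and, for every $G\in\mathcal G\setminus\mathcal H$, $\Gamma(\mathcal H\cup\{G\})$ is connected. $\Pi^\star(\mathcal G)$ is the set of all maximal disconnected collections of $\mathcal G$. *)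

theory Defs
  imports "HOL-Probability.Probability"
begin

section \<open>Matrices\<close>

text \<open>Square matrices are indexed by a finite type \<open>'n\<close>; the vertex set is \<open>UNIV :: 'n set\<close>
  and \<open>N = CARD('n)\<close>.\<close>

definition symmetric_matrix :: "real^'n^'n \<Rightarrow> bool" where
  "symmetric_matrix A \<longleftrightarrow> transpose A = A"

definition doubly_stochastic :: "real^'n^'n \<Rightarrow> bool" where
  "doubly_stochastic A \<longleftrightarrow>
     (\<forall>i j. 0 \<le> A $ i $ j) \<and> (\<forall>i. (\<Sum>j\<in>UNIV. A $ i $ j) = 1) \<and> (\<forall>j. (\<Sum>i\<in>UNIV. A $ i $ j) = 1)"

text \<open>\<^const>\<open>onorm\<close> is taken with respect to the Euclidean norm on \<open>real^'n\<close>.\<close>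

definition spectral_norm :: "real^'n^'n \<Rightarrow> real" where
  "spectral_norm A = onorm (\<lambda>x. A *v x)"

definition avg_matrix :: "real^'n^'n" where
  "avg_matrix = (1 / real CARD('n)) *\<^sub>R (\<chi> i j. 1)"

text \<open>\<open>mat_prod A k = A k ** A (k - 1) ** \<dots> ** A 1\<close>; the entry \<open>A 0\<close> is never used.\<close>

primrec mat_prod :: "(nat \<Rightarrow> real^'n^'n) \<Rightarrow> nat \<Rightarrow> real^'n^'n" where
  "mat_prod A 0 = mat 1"
| "mat_prod A (Suc k) = A (Suc k) ** mat_prod A k"

definition error_matrix :: "(nat \<Rightarrow> 'a \<Rightarrow> real^'n^'n) \<Rightarrow> nat \<Rightarrow> 'a \<Rightarrow> real^'n^'n" where
  "error_matrix W k \<omega> = mat_prod (\<lambda>t. W t \<omega>) k - avg_matrix"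


section \<open>Undirected graphs and collections of graphs\<close>

text \<open>A graph is a pair of a vertex set and a set of edges, each edge being a two-element set.\<close>

type_synonym 'v ugraph = "'v set \<times> 'v set set"

definition connected_graph :: "'v ugraph \<Rightarrow> bool" where
  "connected_graph G \<longleftrightarrow>
     (\<forall>u\<in>fst G. \<forall>v\<in>fst G. (u, v) \<in> {(x, y). x \<in> fst G \<and> y \<in> fst G \<and> {x, y} \<in> snd G}\<^sup>*)"

definition induced_graph :: "real^'n^'n \<Rightarrow> 'n ugraph" where
  "induced_graph A = (UNIV, {{i, j} | i j. i \<noteq> j \<and> A $ i $ j > 0})"

definition supergraph :: "'n ugraph set \<Rightarrow> 'n ugraph" where
  "supergraph \<H> = (UNIV, \<Union>G\<in>\<H>. snd G)"

definition disconnected_collection :: "'n ugraph set \<Rightarrow> 'n ugraph set \<Rightarrow> bool" where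
  "disconnected_collection \<G> \<H> \<longleftrightarrow>
     \<H> \<noteq> {} \<and> \<H> \<subseteq> \<G> \<and> \<not> connected_graph (supergraph \<H>)"

definition maximal_disconnected_collection :: "'n ugraph set \<Rightarrow> 'n ugraph set \<Rightarrow> bool" where
  "maximal_disconnected_collection \<G> \<H> \<longleftrightarrow>
     disconnected_collection \<G> \<H> \<and> (\<forall>G\<in>\<G> - \<H>. connected_graph (supergraph (\<H> \<union> {G})))"

definition max_disconnected_collections :: "'n ugraph set \<Rightarrow> 'n ugraph set set" where
  "max_disconnected_collections \<G> = {\<H>. maximal_disconnected_collection \<G> \<H>}"


section \<open>The random matrix process\<close>

text \<open>The process is \<open>W 1, W 2, \<dots>\<close>; the value \<open>W 0\<close> is irrelevant.\<close>

definition iid_matrices :: "'a measure \<Rightarrow> (nat \<Rightarrow> 'a \<Rightarrow> real^'n^'n) \<Rightarrow> bool" where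
  "iid_matrices M W \<longleftrightarrow>
     prob_space.indep_vars M (\<lambda>_. borel) W {1..} \<and>
     (\<forall>k\<ge>1. distr M borel (W k) = distr M borel (W 1))"

definition realizations :: "'a measure \<Rightarrow> (nat \<Rightarrow> 'a \<Rightarrow> real^'n^'n) \<Rightarrow> (real^'n^'n) set" where
  "realizations M W = {W k \<omega> | k \<omega>. k \<ge> 1 \<and> \<omega> \<in> space M}"

definition realizable_graphs :: "'a measure \<Rightarrow> (nat \<Rightarrow> 'a \<Rightarrow> real^'n^'n) \<Rightarrow> 'n ugraph set" where
  "realizable_graphs M W = induced_graph ` realizations M W"

definition graph_process :: "(nat \<Rightarrow> 'a \<Rightarrow> real^'n^'n) \<Rightarrow> nat \<Rightarrow> 'a \<Rightarrow> 'n ugraph" where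
  "graph_process W t \<omega> = induced_graph (W t \<omega>)"

text \<open>For identically distributed matrices the law of \<open>graph_process W t\<close> is the same for all
  \<open>t \<ge> 1\<close>, so the collection probability is taken at \<open>t = 1\<close>.\<close>

definition collection_prob ::
    "'a measure \<Rightarrow> (nat \<Rightarrow> 'a \<Rightarrow> real^'n^'n) \<Rightarrow> 'n ugraph set \<Rightarrow> real" where
  "collection_prob M W \<H> =
     (\<Sum>H\<in>\<H>. measure M {\<omega> \<in> space M. graph_process W 1 \<omega> = H})"

definition p_max :: "'a measure \<Rightarrow> (nat \<Rightarrow> 'a \<Rightarrow> real^'n^'n) \<Rightarrow> real" where
  "p_max M W = Max (collection_prob M W ` max_disconnected_collections (realizable_graphs M W))"

text \<open>Logarithm of a nonnegative real with the convention \<open>log 0 = -\<infinity>\<close> (the library's \<open>ln 0\<close> is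
  a real number). Only used at probabilities.\<close>

definition ext_ln :: "real \<Rightarrow> ereal" where
  "ext_ln p = (if p \<le> 0 then - \<infinity> else ereal (ln p))"

definition rate :: "'a measure \<Rightarrow> (nat \<Rightarrow> 'a \<Rightarrow> real^'n^'n) \<Rightarrow> ereal" where
  "rate M W =
     (if max_disconnected_collections (realizable_graphs M W) = {} then \<infinity>
      else \<bar>ext_ln (p_max M W)\<bar>)"

end

theory Submission
  imports Defs
begin

text \<open>For \<open>x\<close> with coordinate sum zero, \<open>|x|\<^sup>2\<close> never increases under the matrices, and it shrinks by a
  factor \<open>1 - \<delta> / (2 N\<^sup>3)\<close> over every time window whose graphs have connected union, whatever the length
  of the window: sort the coordinates and cut at a largest gap, which has size at least
  \<open>|x| / N powr (3/2)\<close>; until the first edge crosses this cut the gap persists, and the first crossing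
  edge then costs \<open>\<delta> / 2\<close> times the squared gap. A large error after \<open>k\<close> steps thus bounds the number
  of completed windows. Within a window the set of graphs seen so far is a disconnected collection and
  can grow only finitely often, so all but boundedly many steps draw a graph from the current
  disconnected collection, which has probability at most \<open>p_max\<close>. Hence such paths have probability at
  most \<open>C r ^ k\<close> for every \<open>r > p_max\<close>. Conversely, if all graphs lie in one disconnected collection,
  the indicator of a component is preserved and the error is at least 1.\<close>

section \<open>Cuts\<close>

definition crosses :: "'v set \<Rightarrow> 'v ugraph \<Rightarrow> bool" where
  "crosses S G \<longleftrightarrow> (\<exists>i j. i \<in> S \<and> j \<notin> S \<and> {i, j} \<in> snd G)"

text \<open>A path from \<open>u\<close> to \<open>v\<close> has to leave \<open>S\<close> along
  some edge.\<close>

lemma connected_graph_crosses: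
  assumes "connected_graph G" "fst G = UNIV" "u \<in> S" "v \<notin> S"
  shows "crosses S G"
proof (rule ccontr)
  assume no: "\<not> crosses S G"
  have "(u, v) \<in> {(x, y). {x, y} \<in> snd G}\<^sup>*"
    using assms(1,2) by (simp add: connected_graph_def)
  then have "v \<in> S"
    by (induction rule: rtrancl_induct) (use no assms(3) in \<open>auto simp: crosses_def\<close>)
  with assms(4) show False by simp
qed

text \<open>If \<open>v\<close> cannot be reached from \<open>u\<close>, the set of vertices
  reachable from \<open>u\<close> is closed under edges and misses \<open>v\<close>.\<close>

lemma disconnected_graph_cut:
  assumes "\<not> connected_graph G" "fst G = UNIV"
  obtains S u v where "u \<in> S" "v \<notin> S" "\<not> crosses S G"
proof -
  let ?R = "{(x, y). {x, y} \<in> snd G}"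
  obtain u v where uv: "(u, v) \<notin> ?R\<^sup>*"
    using assms by (auto simp: connected_graph_def)
  show thesis
  proof (rule that[of u "{w. (u, w) \<in> ?R\<^sup>*}" v])
    show "\<not> crosses {w. (u, w) \<in> ?R\<^sup>*} G"
      unfolding crosses_def by (auto dest: rtrancl_into_rtrancl[where r = ?R])
  qed (use uv in auto)
qed

lemma fst_supergraph [simp]: "fst (supergraph H) = UNIV"
  by (simp add: supergraph_def)

lemma crosses_supergraph: "crosses S (supergraph H) \<longleftrightarrow> (\<exists>G\<in>H. crosses S G)"
  by (auto simp: crosses_def supergraph_def)

lemma crosses_induced_graph:
  "crosses S (induced_graph A) \<longleftrightarrow> (\<exists>i j. i \<in> S \<and> j \<notin> S \<and> (A $ i $ j > 0 \<or> A $ j $ i > 0))"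
  by (auto simp: crosses_def induced_graph_def doubleton_eq_iff)

lemma no_crossing_zero:
  assumes "doubly_stochastic A" "\<not> crosses S (induced_graph A)" "(i \<in> S) \<noteq> (j \<in> S)"
  shows "A $ i $ j = 0"
  using assms unfolding crosses_induced_graph doubly_stochastic_def
  by (metis order_less_le)

text \<open>There are only finitely many graphs on a finite vertex type, so an inclusion-maximal
  disconnected collection above \<open>H\<close> exists. Adding any further graph must connect
  it.\<close>

lemma disconnected_collection_extends:
  fixes \<G> :: "'v::finite ugraph set"
  assumes "disconnected_collection \<G> H"
  obtains H' where "H' \<in> max_disconnected_collections \<G>" "H \<subseteq> H'"
proof -
  let ?D = "{H'. disconnected_collection \<G> H' \<and> H \<subseteq> H'}"
  have "H \<in> ?D" using assms by simp
  from finite_has_maximal2[OF finite this]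
  obtain H' where H': "H' \<in> ?D" "\<forall>K\<in>?D. H' \<subseteq> K \<longrightarrow> H' = K" by (elim bexE conjE)
  have "connected_graph (supergraph (H' \<union> {G}))" if "G \<in> \<G> - H'" for G
  proof (rule ccontr)
    assume "\<not> ?thesis"
    then have "H' \<union> {G} \<in> ?D"
      using H'(1) that unfolding disconnected_collection_def by blast
    with H'(2) have "H' = H' \<union> {G}" by blast
    with that show False by blast
  qed
  then show thesis
    using H'(1)
    by (intro that[of H']) (simp_all add: max_disconnected_collections_def maximal_disconnected_collection_def)
qed


section \<open>Contraction\<close>

lemma norm_vec_sq: "(norm x)\<^sup>2 = (\<Sum>i\<in>UNIV. (x $ i)\<^sup>2)" for x :: "real^'n"
  unfolding power2_norm_eq_inner inner_vec_def by (simp add: power2_eq_square)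

text \<open>Row \<open>i\<close> is a probability distribution under which \<open>x\<close> has mean
  \<open>(A *v x) $ i\<close>, so the inner sum is a variance: second moment minus squared mean. The
  column sums turn the total of the second moments into the squared norm of
  \<open>x\<close>.\<close>

lemma doubly_stochastic_drop:
  fixes A :: "real^'n^'n"
  assumes "doubly_stochastic A"
  shows "(norm x)\<^sup>2 - (norm (A *v x))\<^sup>2 = (\<Sum>i\<in>UNIV. \<Sum>l\<in>UNIV. A $ i $ l * (x $ l - (A *v x) $ i)\<^sup>2)"
proof -
  define y where "y = A *v x"
  have row: "(\<Sum>l\<in>UNIV. A $ i $ l * (x $ l - y $ i)\<^sup>2) = (\<Sum>l\<in>UNIV. A $ i $ l * (x $ l)\<^sup>2) - (y $ i)\<^sup>2" for i
  proof -
    have "(\<Sum>l\<in>UNIV. A $ i $ l * (x $ l - y $ i)\<^sup>2)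
        = (\<Sum>l\<in>UNIV. A $ i $ l * (x $ l)\<^sup>2) - 2 * y $ i * (\<Sum>l\<in>UNIV. A $ i $ l * x $ l)
          + (\<Sum>l\<in>UNIV. A $ i $ l * (y $ i)\<^sup>2)"
      by (simp add: power2_diff algebra_simps sum.distrib sum_subtractf sum_distrib_left)
    also have "(\<Sum>l\<in>UNIV. A $ i $ l * x $ l) = y $ i"
      by (simp add: y_def matrix_vector_mult_def)
    also have "(\<Sum>l\<in>UNIV. A $ i $ l * (y $ i)\<^sup>2) = (y $ i)\<^sup>2"
      using assms by (simp add: doubly_stochastic_def flip: sum_distrib_right)
    finally show ?thesis by (simp add: power2_eq_square)
  qed
  have "(\<Sum>i\<in>UNIV. \<Sum>l\<in>UNIV. A $ i $ l * (x $ l)\<^sup>2) = (\<Sum>l\<in>UNIV. (\<Sum>i\<in>UNIV. A $ i $ l) * (x $ l)\<^sup>2)"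
    by (subst sum.swap) (simp add: sum_distrib_right)
  also have "\<dots> = (norm x)\<^sup>2"
    using assms by (simp add: norm_vec_sq doubly_stochastic_def)
  finally show ?thesis
    unfolding y_def[symmetric] row norm_vec_sq[of y] by (simp add: sum_subtractf)
qed

lemma doubly_stochastic_norm_le:
  fixes A :: "real^'n^'n"
  assumes "doubly_stochastic A"
  shows "(norm (A *v x))\<^sup>2 \<le> (norm x)\<^sup>2"
proof -
  have "0 \<le> (\<Sum>i\<in>UNIV. \<Sum>l\<in>UNIV. A $ i $ l * (x $ l - (A *v x) $ i)\<^sup>2)"
    using assms by (intro sum_nonneg) (auto simp: doubly_stochastic_def)
  then show ?thesis using doubly_stochastic_drop[OF assms, of x] by linarith
qed

lemma sum_doubly_stochastic_mult:
  fixes A :: "real^'n^'n"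
  assumes "doubly_stochastic A"
  shows "(\<Sum>i\<in>UNIV. (A *v x) $ i) = (\<Sum>i\<in>UNIV. x $ i)"
proof -
  have "(\<Sum>i\<in>UNIV. (A *v x) $ i) = (\<Sum>l\<in>UNIV. (\<Sum>i\<in>UNIV. A $ i $ l) * x $ l)"
    unfolding matrix_vector_mult_def by (simp add: sum_distrib_right) (rule sum.swap)
  then show ?thesis using assms by (simp add: doubly_stochastic_def)
qed

definition admissible :: "real \<Rightarrow> real^'n^'n \<Rightarrow> bool" where
  "admissible \<delta> A \<longleftrightarrow> doubly_stochastic A \<and> (\<forall>i j. A $ i $ j > 0 \<longrightarrow> A $ i $ j \<ge> \<delta>) \<and> (\<forall>i. A $ i $ i \<ge> \<delta>)"

definition separated :: "'n set \<Rightarrow> real \<Rightarrow> real \<Rightarrow> real^'n \<Rightarrow> bool" where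
  "separated S a b x \<longleftrightarrow> (\<forall>i\<in>S. x $ i \<le> a) \<and> (\<forall>i\<in>-S. b \<le> x $ i)"

text \<open>In the variance of row \<open>i\<close>, both \<open>i\<close> (through the diagonal
  entry) and \<open>j\<close> carry weight at least \<open>\<delta>\<close>, and the mean of the row
  cannot be close to both \<open>x $ i\<close> and \<open>x $ j\<close>.\<close>

lemma edge_drop:
  fixes A :: "real^'n^'n"
  assumes adm: "admissible \<delta> A" and "0 < \<delta>" and "i \<noteq> j" "A $ i $ j > 0"
  shows "(norm (A *v x))\<^sup>2 \<le> (norm x)\<^sup>2 - \<delta> / 2 * (x $ i - x $ j)\<^sup>2"
proof -
  have ds: "doubly_stochastic A" and nn: "\<And>i j. 0 \<le> A $ i $ j"
    using adm by (auto simp: admissible_def doubly_stochastic_def)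
  define y where "y = (A *v x) $ i"
  have "\<delta> / 2 * (x $ i - x $ j)\<^sup>2 \<le> \<delta> * ((x $ i - y)\<^sup>2 + (x $ j - y)\<^sup>2)"
  proof -
    have "(x $ i - x $ j)\<^sup>2 \<le> 2 * ((x $ i - y)\<^sup>2 + (x $ j - y)\<^sup>2)"
      \<comment> \<open>With \<open>u = x $ i - y\<close> and \<open>v = x $ j - y\<close>, this is
        \<open>2 * (u^2 + v^2) - (u - v)^2 = (u + v)^2\<close>.\<close>
      using zero_le_power2[of "x $ i + x $ j - 2 * y"] by (simp add: power2_eq_square algebra_simps)
    then show ?thesis using \<open>0 < \<delta>\<close> by simp
  qed
  also have "\<dots> \<le> A $ i $ i * (x $ i - y)\<^sup>2 + A $ i $ j * (x $ j - y)\<^sup>2"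
    unfolding distrib_left using adm assms(4)
    by (intro add_mono mult_right_mono) (auto simp: admissible_def)
  also have "\<dots> = (\<Sum>l\<in>{i, j}. A $ i $ l * (x $ l - y)\<^sup>2)"
    using \<open>i \<noteq> j\<close> by simp
  also have "\<dots> \<le> (\<Sum>l\<in>UNIV. A $ i $ l * (x $ l - y)\<^sup>2)"
    by (rule sum_mono2) (auto simp: nn)
  also have "\<dots> \<le> (\<Sum>i\<in>UNIV. \<Sum>l\<in>UNIV. A $ i $ l * (x $ l - (A *v x) $ i)\<^sup>2)"
    unfolding y_def
    by (rule member_le_sum[of i UNIV "\<lambda>i. \<Sum>l\<in>UNIV. A $ i $ l * (x $ l - (A *v x) $ i)\<^sup>2"])
      (auto intro!: sum_nonneg simp: nn)
  finally show ?thesis using doubly_stochastic_drop[OF ds, of x] by linarith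
qed

lemma crossing_drop:
  fixes A :: "real^'n^'n"
  assumes adm: "admissible \<delta> A" and "0 < \<delta>" and sep: "separated S a b x" "a \<le> b"
    and cr: "crosses S (induced_graph A)"
  shows "(norm (A *v x))\<^sup>2 \<le> (norm x)\<^sup>2 - \<delta> / 2 * (b - a)\<^sup>2"
proof -
  obtain i j where ij: "i \<in> S" "j \<notin> S" "A $ i $ j > 0 \<or> A $ j $ i > 0"
    using cr unfolding crosses_induced_graph by blast
  then have "i \<noteq> j" by auto
  have "(b - a)\<^sup>2 \<le> (x $ j - x $ i)\<^sup>2"
    using ij sep by (intro power_mono) (force simp: separated_def)+
  then have "\<delta> / 2 * (b - a)\<^sup>2 \<le> \<delta> / 2 * (x $ j - x $ i)\<^sup>2"
    using \<open>0 < \<delta>\<close> by (intro mult_left_mono) auto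
  \<comment> \<open>The crossing edge may come from either of the two entries, so the drop is
    applied in both orders.\<close>
  then show ?thesis
    using edge_drop[OF adm \<open>0 < \<delta>\<close> \<open>i \<noteq> j\<close>, of x] edge_drop[OF adm \<open>0 < \<delta>\<close> \<open>i \<noteq> j\<close>[symmetric], of x] ij(3)
    by (auto simp: power2_commute[of "x $ i"])
qed

text \<open>Entries joining the two sides vanish, so each new coordinate is a convex combination of
  old coordinates on its own side.\<close>

lemma separated_mult:
  fixes A :: "real^'n^'n"
  assumes ds: "doubly_stochastic A" and sep: "separated S a b x"
    and cr: "\<not> crosses S (induced_graph A)"
  shows "separated S a b (A *v x)"
proof -
  have nn: "0 \<le> A $ i $ j" and row: "(\<Sum>j\<in>UNIV. A $ i $ j) = 1" for i j
    using ds by (auto simp: doubly_stochastic_def)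
  have "(A *v x) $ i \<le> a" if "i \<in> S" for i
  proof -
    have "(A *v x) $ i \<le> (\<Sum>j\<in>UNIV. A $ i $ j * a)"
      unfolding matrix_vector_mult_def vec_lambda_beta
    proof (rule sum_mono)
      fix j show "A $ i $ j * x $ j \<le> A $ i $ j * a"
        using no_crossing_zero[OF ds cr, of i j] that sep nn[of i j]
        by (cases "j \<in> S") (auto simp: separated_def intro: mult_left_mono)
    qed
    then show ?thesis by (simp add: row flip: sum_distrib_right)
  qed
  moreover have "b \<le> (A *v x) $ i" if "i \<notin> S" for i
  proof -
    have "(\<Sum>j\<in>UNIV. A $ i $ j * b) \<le> (A *v x) $ i"
      unfolding matrix_vector_mult_def vec_lambda_beta
    proof (rule sum_mono)
      fix j show "A $ i $ j * b \<le> A $ i $ j * x $ j"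
        using no_crossing_zero[OF ds cr, of i j] that sep nn[of i j]
        by (cases "j \<in> S") (auto simp: separated_def intro: mult_left_mono)
    qed
    then show ?thesis by (simp add: row flip: sum_distrib_right)
  qed
  ultimately show ?thesis by (simp add: separated_def)
qed

text \<open>Before the first crossing edge the two sides of the cut do not interact, so the gap is still
  there when the crossing edge appears, however long that takes.\<close>

lemma orbit_separated_or_drop:
  fixes x :: "nat \<Rightarrow> real^'n"
  assumes adm: "\<And>t. t \<ge> 1 \<Longrightarrow> admissible \<delta> (A t)" and \<delta>: "0 < \<delta>"
    and x: "\<And>t. x (Suc t) = A (Suc t) *v x t"
    and sep: "separated S a b (x s)" "a \<le> b" and "s \<le> k"
  shows "((\<forall>t\<in>{s<..k}. \<not> crosses S (induced_graph (A t))) \<and> separated S a b (x k) \<and> (norm (x k))\<^sup>2 \<le> (norm (x s))\<^sup>2)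
     \<or> (norm (x k))\<^sup>2 \<le> (norm (x s))\<^sup>2 - \<delta> / 2 * (b - a)\<^sup>2"
  using \<open>s \<le> k\<close>
proof (induction k rule: dec_induct)
  case base
  then show ?case using sep by simp
next
  case (step k)
  have ds: "doubly_stochastic (A (Suc k))" and ad: "admissible \<delta> (A (Suc k))"
    using adm[of "Suc k"] by (auto simp: admissible_def)
  have le: "(norm (x (Suc k)))\<^sup>2 \<le> (norm (x k))\<^sup>2"
    unfolding x by (rule doubly_stochastic_norm_le[OF ds])
  show ?case
  proof (cases "(norm (x k))\<^sup>2 \<le> (norm (x s))\<^sup>2 - \<delta> / 2 * (b - a)\<^sup>2")
    case True
    then show ?thesis using le by linarith
  next
    case False
    then have no: "\<forall>t\<in>{s<..k}. \<not> crosses S (induced_graph (A t))" and sk: "separated S a b (x k)"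
      and le': "(norm (x k))\<^sup>2 \<le> (norm (x s))\<^sup>2"
      using step.IH by auto
    show ?thesis
    proof (cases "crosses S (induced_graph (A (Suc k)))")
      case True
      then show ?thesis
        using crossing_drop[OF ad \<delta> sk sep(2) True] le' unfolding x by linarith
    next
      case False
      have "separated S a b (x (Suc k))"
        unfolding x by (rule separated_mult[OF ds sk False])
      then show ?thesis using no False le le' by (auto simp: le_Suc_eq)
    qed
  qed
qed

lemma exists_large_gap:
  fixes x :: "real^'n"
  assumes "(\<Sum>i\<in>UNIV. x $ i) = 0" "x \<noteq> 0"
  obtains S u v a b where "u \<in> S" "v \<notin> S" "a \<le> b" "separated S a b x"
    "(norm x)\<^sup>2 / real CARD('n) ^ 3 \<le> (b - a)\<^sup>2"
proof -
  let ?N = "CARD('n)"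
  define m where "m = Min (range (\<lambda>i. x $ i))"
  define M where "M = Max (range (\<lambda>i. x $ i))"
  have m_le: "m \<le> x $ i" and le_M: "x $ i \<le> M" for i
    by (auto simp: m_def M_def)
  have "m \<in> range (\<lambda>i. x $ i)" "M \<in> range (\<lambda>i. x $ i)"
    unfolding m_def M_def by (intro Min_in Max_in; simp)+
  then obtain u v where u: "x $ u = m" and v: "x $ v = M" by auto
  have "m \<le> 0"
  proof (rule ccontr)
    assume "\<not> m \<le> 0"
    then have "0 < (\<Sum>i\<in>UNIV. x $ i)"
      using m_le by (intro sum_pos) (auto intro: less_le_trans[of 0 m])
    with assms(1) show False by simp
  qed
  have "0 \<le> M"
  proof (rule ccontr)
    assume "\<not> 0 \<le> M"
    then have "(\<Sum>i\<in>UNIV. x $ i) < (\<Sum>i\<in>(UNIV :: 'n set). 0)"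
      using le_M by (intro sum_strict_mono) (auto intro: le_less_trans[of _ M])
    with assms(1) show False by simp
  qed
  \<comment> \<open>Zero sum puts 0 between the minimum and the maximum, so the spread controls the
    norm.\<close>
  have ab: "\<bar>x $ i\<bar> \<le> M - m" for i
    using m_le[of i] le_M[of i] \<open>m \<le> 0\<close> \<open>0 \<le> M\<close> by linarith
  obtain i where "x $ i \<noteq> 0" using assms(2) by (auto simp: vec_eq_iff)
  then have pos: "0 < M - m" using ab[of i] by linarith
  have V: "(norm x)\<^sup>2 \<le> real ?N * (M - m)\<^sup>2"
    unfolding norm_vec_sq using ab
    by (intro order.trans[OF sum_bounded_above[where K = "(M - m)\<^sup>2"]]) (auto simp: abs_le_square_iff intro!: power2_le_iff_abs_le[THEN iffD2] less_imp_le[OF pos])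
  define g where "g = (M - m) / real ?N"
  have g: "0 < g" using pos by (simp add: g_def)
  \<comment> \<open>Label \<open>j \<ge> 1\<close> stands for the half-open cell from
    \<open>m + (j - 1) * g\<close> (excluded) to \<open>m + j * g\<close> (included); label 0 only
    for the value \<open>m\<close>.\<close>
  define f where "f i = nat \<lceil>(x $ i - m) / g\<rceil>" for i
  have rg: "real ?N * g = M - m" by (simp add: g_def)
  have f_le: "f i \<le> ?N" for i
  proof -
    have "(x $ i - m) / g \<le> real ?N"
      using le_M[of i] g rg by (simp add: pos_divide_le_eq)
    then show ?thesis by (simp add: f_def ceiling_le_iff)
  qed
  have "f u = 0" by (simp add: f_def u)
  have "card (range f) < card {0..?N}"
    using card_image_le[of UNIV f] by simp
  then have "\<not> {0..?N} \<subseteq> range f"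
    using card_mono[of "range f" "{0..?N}"] by force
  then obtain j where j: "j \<le> ?N" "j \<notin> range f"
    by (metis atLeastAtMost_iff subsetI)
  have "j \<noteq> 0" using j(2) \<open>f u = 0\<close> by (metis rangeI)
  define a where "a = m + (real j - 1) * g"
  define b where "b = m + real j * g"
  have dich: "x $ i \<le> a \<or> b < x $ i" for i
  proof (rule ccontr)
    assume c: "\<not> ?thesis"
    then have "real j - 1 < (x $ i - m) / g" "(x $ i - m) / g \<le> real j"
      using g by (auto simp: a_def b_def field_simps)
    then have "\<lceil>(x $ i - m) / g\<rceil> = int j" by linarith
    then have "f i = j" by (simp add: f_def)
    with j(2) show False by auto
  qed
  show thesis
  proof (rule that[of u "{i. x $ i \<le> a}" v a b])
    show "u \<in> {i. x $ i \<le> a}" using u g \<open>j \<noteq> 0\<close> by (simp add: a_def)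
    have "(real j - 1) * g < real ?N * g"
      using j(1) g by (intro mult_strict_right_mono) auto
    then show "v \<notin> {i. x $ i \<le> a}" using v rg by (simp add: a_def)
    show "a \<le> b" using g by (simp add: a_def b_def algebra_simps)
    show "separated {i. x $ i \<le> a} a b x"
      using dich by (force simp: separated_def)
    have "b - a = g" by (simp add: a_def b_def algebra_simps)
    \<comment> \<open>Two factors of \<open>N\<close> come from the cell length and the third from
      bounding the squared norm by \<open>N\<close> times the squared spread.\<close>
    then have "(b - a)\<^sup>2 = real ?N * (M - m)\<^sup>2 / real ?N ^ 3"
      by (simp add: g_def power_divide power2_eq_square power3_eq_cube)
    then show "(norm x)\<^sup>2 / real ?N ^ 3 \<le> (b - a)\<^sup>2"
      using divide_right_mono[OF V, of "real ?N ^ 3"] by simp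
  qed
qed

text \<open>The cut is chosen from the vector at the start of the window. A connected union must
  cross it at some time in the window, which rules out the first alternative of
  \<open>orbit_separated_or_drop\<close>.\<close>

lemma connected_window_contraction:
  fixes x :: "nat \<Rightarrow> real^'n"
  assumes adm: "\<And>t. t \<ge> 1 \<Longrightarrow> admissible \<delta> (A t)" and \<delta>: "0 < \<delta>"
    and x: "\<And>t. x (Suc t) = A (Suc t) *v x t"
    and zero: "(\<Sum>i\<in>UNIV. x s $ i) = 0" and "s \<le> k"
    and con: "connected_graph (supergraph ((\<lambda>t. induced_graph (A t)) ` {s<..k}))"
  shows "(norm (x k))\<^sup>2 \<le> (1 - \<delta> / (2 * real CARD('n) ^ 3)) * (norm (x s))\<^sup>2"
proof (cases "x s = 0")
  case True
  have "x k = 0" using \<open>s \<le> k\<close>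
    by (induction k rule: dec_induct) (auto simp: True x)
  then show ?thesis by (simp add: True)
next
  case False
  obtain S u v a b where S: "u \<in> S" "v \<notin> S" "a \<le> b" "separated S a b (x s)"
    and gap: "(norm (x s))\<^sup>2 / real CARD('n) ^ 3 \<le> (b - a)\<^sup>2"
    using exists_large_gap[OF zero False] .
  have "crosses S (supergraph ((\<lambda>t. induced_graph (A t)) ` {s<..k}))"
    using connected_graph_crosses[OF con _ S(1,2)] by simp
  then have "(norm (x k))\<^sup>2 \<le> (norm (x s))\<^sup>2 - \<delta> / 2 * (b - a)\<^sup>2"
    using orbit_separated_or_drop[where x = x, OF adm \<delta> x S(4,3) \<open>s \<le> k\<close>] by (auto simp: crosses_supergraph)
  also have "\<dots> \<le> (norm (x s))\<^sup>2 - \<delta> / 2 * ((norm (x s))\<^sup>2 / real CARD('n) ^ 3)"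
    using gap \<delta> by (intro diff_left_mono mult_left_mono) auto
  finally show ?thesis by (simp add: algebra_simps)
qed

section \<open>Counting connected windows\<close>

text \<open>The argument is the list of graphs seen so far, most recent first. The first component of the
  result is the number of completed windows with connected union, the second one collects the graphs
  of the current window.\<close>

primrec windows :: "'v ugraph list \<Rightarrow> nat \<times> 'v ugraph set" where
  "windows [] = (0, {})"
| "windows (g # gs) =
     (if connected_graph (supergraph (insert g (snd (windows gs)))) then (Suc (fst (windows gs)), {})
      else (fst (windows gs), insert g (snd (windows gs))))"

primrec past :: "(nat \<Rightarrow> 'b) \<Rightarrow> nat \<Rightarrow> 'b list" where
  "past g 0 = []"
| "past g (Suc k) = g (Suc k) # past g k"

lemma mat_prod_windows_bound:
  fixes A :: "nat \<Rightarrow> real^'n^'n"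
  assumes adm: "\<And>t. t \<ge> 1 \<Longrightarrow> admissible \<delta> (A t)" and \<delta>: "0 < \<delta>" "\<delta> \<le> 1"
    and zero: "(\<Sum>i\<in>UNIV. y $ i) = 0"
  shows "(norm (mat_prod A k *v y))\<^sup>2
    \<le> (1 - \<delta> / (2 * real CARD('n) ^ 3)) ^ fst (windows (past (\<lambda>t. induced_graph (A t)) k)) * (norm y)\<^sup>2"
proof -
  define c where "c = 1 - \<delta> / (2 * real CARD('n) ^ 3)"
  define x where "x t = mat_prod A t *v y" for t
  define g where "g t = induced_graph (A t)" for t
  have ds: "doubly_stochastic (A (Suc t))" for t
    using adm[of "Suc t"] by (auto simp: admissible_def)
  have x: "x (Suc t) = A (Suc t) *v x t" for t
    by (simp add: x_def matrix_vector_mul_assoc)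
  have z: "(\<Sum>i\<in>UNIV. x t $ i) = 0" for t
    by (induction t) (auto simp: x sum_doubly_stochastic_mult[OF ds], simp add: x_def zero)
  have "1 \<le> real CARD('n) ^ 3" by simp
  then have "\<delta> \<le> 2 * real CARD('n) ^ 3" using \<delta>(2) by linarith
  then have c0: "0 \<le> c" by (simp add: c_def)
  have mono: "(norm (x k))\<^sup>2 \<le> (norm (x s))\<^sup>2" if "s \<le> k" for s k
    using that
  proof (induction k rule: dec_induct)
    case (step k)
    then show ?case using doubly_stochastic_norm_le[OF ds, of k "x k"] by (simp add: x)
  qed simp
  \<comment> \<open>Here \<open>s\<close> is the time at which the current window starts. The
    estimate is kept at time \<open>s\<close> because the next contraction is measured from there;
    monotonicity carries it to \<open>k\<close> at the end.\<close>
  have "\<exists>s\<le>k. (norm (x s))\<^sup>2 \<le> c ^ fst (windows (past g k)) * (norm y)\<^sup>2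
      \<and> snd (windows (past g k)) = g ` {s<..k}" for k
  proof (induction k)
    case 0
    then show ?case by (simp add: x_def)
  next
    case (Suc k)
    then obtain s where s: "s \<le> k" "(norm (x s))\<^sup>2 \<le> c ^ fst (windows (past g k)) * (norm y)\<^sup>2"
      "snd (windows (past g k)) = g ` {s<..k}" by blast
    have ins: "insert (g (Suc k)) (g ` {s<..k}) = g ` {s<..Suc k}"
      using s(1) by (auto simp: le_Suc_eq)
    show ?case
    proof (cases "connected_graph (supergraph (g ` {s<..Suc k}))")
      case True
      have "(norm (x (Suc k)))\<^sup>2 \<le> c * (norm (x s))\<^sup>2"
        unfolding c_def
        by (rule connected_window_contraction[where A = A, OF adm \<delta>(1) x z])
          (use True s(1) in \<open>auto simp: g_def[abs_def]\<close>)
      also have "\<dots> \<le> c * (c ^ fst (windows (past g k)) * (norm y)\<^sup>2)"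
        using s(2) c0 by (rule mult_left_mono)
      finally show ?thesis
        using True s by (intro exI[of _ "Suc k"]) (auto simp: ins mult.assoc)
    next
      case False
      then show ?thesis using s by (intro exI[of _ s]) (auto simp: ins)
    qed
  qed
  then obtain s where "s \<le> k" "(norm (x s))\<^sup>2 \<le> c ^ fst (windows (past g k)) * (norm y)\<^sup>2" by blast
  with mono[of s k] show ?thesis unfolding x_def c_def g_def[abs_def] by linarith
qed

section \<open>Spectral norm of the error matrix\<close>

lemma avg_matrix_mult: "avg_matrix *v x = (\<chi> i. (\<Sum>j\<in>UNIV. x $ j) / real CARD('n))"
  for x :: "real^'n"
  by (simp add: avg_matrix_def matrix_vector_mult_def vec_eq_iff sum_divide_distrib)

lemma mat_prod_fixes:
  assumes "\<And>t. t \<in> {1..k} \<Longrightarrow> A t *v x = x"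
  shows "mat_prod A k *v x = x"
  using assms
proof (induction k)
  case (Suc k)
  then show ?case by (simp flip: matrix_vector_mul_assoc)
qed simp

lemma doubly_stochastic_const:
  assumes "doubly_stochastic A"
  shows "A *v (\<chi> i. c) = (\<chi> i. c)"
  using assms by (simp add: doubly_stochastic_def matrix_vector_mult_def vec_eq_iff flip: sum_distrib_right)

text \<open>The constant part \<open>e\<close> of \<open>x\<close> is fixed by the product and
  equals the average of \<open>x\<close>, so it cancels. The error matrix thus acts on
  \<open>x\<close> as the product acts on the zero-sum part \<open>y\<close>, whose norm is at most
  that of \<open>x\<close>.\<close>

lemma spectral_norm_windows_bound:
  fixes A :: "nat \<Rightarrow> real^'n^'n"
  assumes adm: "\<And>t. t \<ge> 1 \<Longrightarrow> admissible \<delta> (A t)" and \<delta>: "0 < \<delta>" "\<delta> \<le> 1"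
  shows "spectral_norm (mat_prod A k - avg_matrix)
    \<le> sqrt ((1 - \<delta> / (2 * real CARD('n) ^ 3)) ^ fst (windows (past (\<lambda>t. induced_graph (A t)) k)))"
    (is "_ \<le> sqrt ?C")
  unfolding spectral_norm_def
proof (rule onorm_le)
  fix x :: "real^'n"
  define e :: "real^'n" where "e = (\<chi> i. (\<Sum>j\<in>UNIV. x $ j) / real CARD('n))"
  define y where "y = x - e"
  have fe: "mat_prod A k *v e = e"
    unfolding e_def using adm
    by (intro mat_prod_fixes doubly_stochastic_const) (auto simp: admissible_def)
  have y0: "(\<Sum>i\<in>UNIV. y $ i) = 0" by (simp add: y_def e_def sum_subtractf)
  have "(mat_prod A k - avg_matrix) *v x = mat_prod A k *v y"
    unfolding y_def matrix_vector_mult_diff_rdistrib matrix_vector_mult_diff_distrib avg_matrix_mult e_def[symmetric] fe ..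
  moreover have 1: "(norm (mat_prod A k *v y))\<^sup>2 \<le> ?C * (norm y)\<^sup>2"
    by (rule mat_prod_windows_bound[OF adm \<delta> y0])
  moreover have 2: "(norm y)\<^sup>2 \<le> (norm x)\<^sup>2"
  proof -
    have "y \<bullet> e = 0"
      using y0 by (simp only: inner_vec_def e_def vec_lambda_beta inner_real_def sum_distrib_right[symmetric] mult_zero_left)
    then show ?thesis
      using norm_add_Pythagorean[of y e] by (simp add: orthogonal_def y_def)
  qed
  moreover have "0 \<le> ?C"
  proof -
    have "1 \<le> real CARD('n) ^ 3" by simp
    then have "\<delta> \<le> 2 * real CARD('n) ^ 3" using \<delta>(2) by linarith
    then show ?thesis by simp
  qed
  ultimately have "(norm ((mat_prod A k - avg_matrix) *v x))\<^sup>2 \<le> ?C * (norm x)\<^sup>2"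
    using order.trans[OF 1 mult_left_mono[OF 2]] by simp
  from real_sqrt_le_mono[OF this]
  show "norm ((mat_prod A k - avg_matrix) *v x) \<le> sqrt ?C * norm x"
    by (simp add: real_sqrt_mult)
qed

text \<open>The centred indicator of an uncrossed vertex set is fixed by every factor and
  annihilated by the averaging matrix, so it is a nonzero eigenvector of the error matrix with
  eigenvalue 1.\<close>

lemma spectral_norm_ge_1:
  fixes A :: "nat \<Rightarrow> real^'n^'n"
  assumes ds: "\<And>t. t \<in> {1..k} \<Longrightarrow> doubly_stochastic (A t)"
    and in_H: "\<And>t. t \<in> {1..k} \<Longrightarrow> induced_graph (A t) \<in> H"
    and disc: "\<not> connected_graph (supergraph H)"
  shows "1 \<le> spectral_norm (mat_prod A k - avg_matrix)"
proof -
  obtain S u v where S: "u \<in> S" "v \<notin> S" "\<not> crosses S (supergraph H)"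
    using disconnected_graph_cut[OF disc fst_supergraph] .
  define e :: "real^'n" where "e = (\<chi> i. real (card S) / real CARD('n))"
  define f :: "real^'n" where "f = (\<chi> i. indicator S i)"
  define y where "y = f - e"
  have "A t *v f = f" if t: "t \<in> {1..k}" for t
  proof -
    have no: "\<not> crosses S (induced_graph (A t))"
      using S(3) in_H[OF t] by (auto simp: crosses_supergraph)
    have "(A t *v f) $ i = indicator S i" for i
    proof -
      have "(A t *v f) $ i = (\<Sum>j\<in>UNIV. A t $ i $ j * indicator S i)"
        unfolding matrix_vector_mult_def vec_lambda_beta f_def
      proof (rule sum.cong)
        fix j show "A t $ i $ j * indicator S j = A t $ i $ j * indicator S i"
          using no_crossing_zero[OF ds[OF t] no, of i j] by (auto simp: indicator_def)
      qed simp
      then show ?thesis using ds[OF t] by (simp add: doubly_stochastic_def flip: sum_distrib_right)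
    qed
    then show ?thesis by (simp add: vec_eq_iff f_def)
  qed
  then have f: "mat_prod A k *v f = f" by (rule mat_prod_fixes)
  have e: "mat_prod A k *v e = e"
    unfolding e_def by (intro mat_prod_fixes doubly_stochastic_const ds)
  have "(\<Sum>j\<in>UNIV. y $ j) = 0"
    by (simp add: y_def f_def e_def sum_subtractf indicator_def)
  then have "avg_matrix *v y = 0" by (simp add: avg_matrix_mult vec_eq_iff)
  moreover have "mat_prod A k *v y = y"
    using f e by (simp add: y_def matrix_vector_mult_diff_distrib)
  ultimately have eq: "(mat_prod A k - avg_matrix) *v y = y"
    by (simp add: matrix_vector_mult_diff_rdistrib)
  have "y $ u \<noteq> y $ v" using S by (simp add: y_def f_def e_def)
  then have "0 < norm y" by auto
  moreover have "norm ((mat_prod A k - avg_matrix) *v y) \<le> spectral_norm (mat_prod A k - avg_matrix) * norm y"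
    unfolding spectral_norm_def by (rule onorm) (rule matrix_vector_mul_bounded_linear)
  ultimately show ?thesis by (simp add: eq)
qed

section \<open>Weighted sums over graph sequences\<close>

lemma windows_current:
  assumes "set gs \<subseteq> \<G>"
  shows "snd (windows gs) \<subseteq> \<G> \<and>
    (snd (windows gs) = {} \<or> \<not> connected_graph (supergraph (snd (windows gs))))"
  using assms by (induction gs) auto

text \<open>Turns a prescribed past into one condition per time, the form to which independence
  applies; index 0 of the list is time \<open>k\<close>.\<close>

lemma past_eq_iff:
  "length l = k \<Longrightarrow> past g k = l \<longleftrightarrow> (\<forall>t\<in>{1..k}. g t = l ! (k - t))"
proof (induction k arbitrary: l)
  case (Suc k)
  then obtain x xs where l: "l = x # xs" "length xs = k"
    by (auto simp: length_Suc_conv)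
  have "{1..Suc k} = insert (Suc k) {1..k}" by auto
  then show ?case
    using Suc.IH[OF l(2)] by (auto simp: l(1) Suc_diff_le)
qed simp

lemma prod_nth_rev:
  fixes f :: "'b \<Rightarrow> 'c::comm_monoid_mult"
  shows "length l = k \<Longrightarrow> (\<Prod>t\<in>{1..k}. f (l ! (k - t))) = prod_list (map f l)"
proof (induction k arbitrary: l)
  case (Suc k)
  then obtain x xs where l: "l = x # xs" "length xs = k"
    by (auto simp: length_Suc_conv)
  have "(\<Prod>t\<in>{1..k}. f (l ! (Suc k - t))) = (\<Prod>t\<in>{1..k}. f (xs ! (k - t)))"
    by (rule prod.cong) (auto simp: l(1) Suc_diff_le)
  then show ?case
    using Suc.IH[OF l(2)] by (simp add: l(1) mult.commute)
qed simp

lemma length_past [simp]: "length (past g k) = k"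
  by (induction k) auto

lemma set_past: "set (past g k) = g ` {1..k}"
  by (induction k) (auto simp: atLeastAtMostSuc_conv)

text \<open>With \<open>n\<close> graphs and \<open>z = \<theta> ^ (n + 1)\<close>, the weight \<open>z ^ c * \<theta> ^ |H|\<close> of the window state \<open>(c, H)\<close> makes the two transitions that
  change the state cost a factor of at most \<open>\<theta>\<close> each, so that only the steps staying in \<open>H\<close>, of
  probability at most \<open>p\<close>, matter.\<close>

definition window_weight :: "nat \<Rightarrow> real \<Rightarrow> nat \<times> 'b set \<Rightarrow> real" where
  "window_weight n \<theta> s = (\<theta> ^ Suc n) ^ fst s * \<theta> ^ card (snd s)"

context
  fixes \<G> :: "'v ugraph set" and q :: "'v ugraph \<Rightarrow> real" and p \<theta> :: real
  assumes fin: "finite \<G>" and q_nonneg: "\<And>g. 0 \<le> q g" and q_sum: "sum q \<G> \<le> 1"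
    and p_nonneg: "0 \<le> p"
    and p: "\<And>H. H \<subseteq> \<G> \<Longrightarrow> \<not> connected_graph (supergraph H) \<Longrightarrow> H \<noteq> {} \<Longrightarrow> sum q H \<le> p"
    and \<theta>: "0 < \<theta>" "\<theta> \<le> 1"
begin

text \<open>With \<open>q\<close> as the law of one graph, this bounds the expected weight after one
  more step. Graphs already in the current window keep the weight and have probability at most
  \<open>p\<close>; all other graphs shrink it.\<close>

lemma window_weight_step:
  assumes "set l \<subseteq> \<G>"
  shows "(\<Sum>g\<in>\<G>. q g * window_weight (card \<G>) \<theta> (windows (g # l)))
    \<le> (p + 2 * \<theta>) * window_weight (card \<G>) \<theta> (windows l)"
proof -
  define c where "c = fst (windows l)"
  define H where "H = snd (windows l)"
  define w where "w = window_weight (card \<G>) \<theta> (windows l)"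
  define z where "z = \<theta> ^ Suc (card \<G>)"
  have H: "H \<subseteq> \<G>" "H = {} \<or> \<not> connected_graph (supergraph H)"
    using windows_current[OF assms] by (auto simp: H_def)
  have w: "w = z ^ c * \<theta> ^ card H"
    by (simp add: w_def window_weight_def c_def H_def z_def)
  have z: "0 < z" using \<theta> by (simp add: z_def)
  have w_pos: "0 < w" using z \<theta> by (simp add: w)
  have le: "window_weight (card \<G>) \<theta> (windows (g # l)) \<le> w * ((if g \<in> H then 1 else 0) + 2 * \<theta>)" for g
  proof -
    consider (conn) "connected_graph (supergraph (insert g H))"
      | (stay) "\<not> connected_graph (supergraph (insert g H))" "g \<in> H"
      | (new) "\<not> connected_graph (supergraph (insert g H))" "g \<notin> H" by blast
    then have "window_weight (card \<G>) \<theta> (windows (g # l)) \<le> w * (if g \<in> H then 1 else 0) + w * \<theta>"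
    proof cases
      case conn
      \<comment> \<open>Completing a window resets the collection and so loses the factor
        \<open>\<theta> ^ card H\<close>. The exponent \<open>Suc (card \<G>)\<close> in
        \<open>z\<close> pays for this and still leaves one factor \<open>\<theta>\<close>.\<close>
      have "\<theta> ^ card \<G> \<le> \<theta> ^ card H"
        using \<theta> card_mono[OF fin H(1)] by (intro power_decreasing) auto
      then have "z ^ c * z \<le> z ^ c * \<theta> ^ card H * \<theta>"
        using \<theta> z by (simp add: z_def mult.commute)
      then have "window_weight (card \<G>) \<theta> (windows (g # l)) \<le> w * \<theta>"
        unfolding window_weight_def z_def[symmetric] w
        using conn by (simp add: mult.commute flip: c_def H_def)
      then show ?thesis using w_pos by (simp add: add_increasing)
    next
      case stay
      then have "window_weight (card \<G>) \<theta> (windows (g # l)) = w"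
        by (simp add: window_weight_def w insert_absorb z_def flip: c_def H_def)
      then show ?thesis using w_pos \<theta> stay by simp
    next
      case new
      have "finite H" using H(1) fin by (rule finite_subset)
      then have "window_weight (card \<G>) \<theta> (windows (g # l)) = w * \<theta>"
        using new by (simp add: window_weight_def w z_def flip: c_def H_def)
      then show ?thesis using new by simp
    qed
    \<comment> \<open>The cases give one \<open>w * \<theta>\<close>; a second one is added as
      slack.\<close>
    moreover have "0 \<le> w * \<theta>" using w_pos \<theta> by simp
    ultimately show ?thesis by (simp add: algebra_simps)
  qed
  have "(\<Sum>g\<in>\<G>. q g * window_weight (card \<G>) \<theta> (windows (g # l)))
      \<le> (\<Sum>g\<in>\<G>. q g * (w * ((if g \<in> H then 1 else 0) + 2 * \<theta>)))"
    using le q_nonneg by (intro sum_mono mult_left_mono) auto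
  also have "\<dots> = w * ((\<Sum>g\<in>\<G>. if g \<in> H then q g else 0) + 2 * \<theta> * sum q \<G>)"
    unfolding distrib_left sum_distrib_left sum.distrib[symmetric]
    by (rule sum.cong) (auto simp: algebra_simps)
  also have "(\<Sum>g\<in>\<G>. if g \<in> H then q g else 0) = sum q H"
    using H(1) fin by (simp add: sum.inter_restrict[symmetric] Int_absorb1)
  also have "w * (sum q H + 2 * \<theta> * sum q \<G>) \<le> w * (p + 2 * \<theta>)"
  proof (intro mult_left_mono add_mono)
    \<comment> \<open>Right after a completed window the collection is empty and has mass 0;
      otherwise it is disconnected.\<close>
    show "sum q H \<le> p" using H p p_nonneg by (cases "H = {}") auto
    show "2 * \<theta> * sum q \<G> \<le> 2 * \<theta>" using q_sum \<theta> by (simp add: mult_le_cancel_left1)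
  qed (use w_pos in auto)
  finally show ?thesis by (simp add: w_def mult.commute)
qed

text \<open>The initial state has weight 1, and splitting off the most recent graph contributes one
  factor \<open>p + 2 * \<theta>\<close> per step.\<close>

lemma window_weight_bound:
  "(\<Sum>l | set l \<subseteq> \<G> \<and> length l = k. prod_list (map q l) * window_weight (card \<G>) \<theta> (windows l))
    \<le> (p + 2 * \<theta>) ^ k"
proof (induction k)
  case 0
  have "{l. set l \<subseteq> \<G> \<and> length l = 0} = {[]}" by auto
  then show ?case by (simp add: window_weight_def)
next
  case (Suc k)
  let ?L = "{l. set l \<subseteq> \<G> \<and> length l = k}"
  let ?w = "\<lambda>l. window_weight (card \<G>) \<theta> (windows l)"
  have bij: "bij_betw (\<lambda>(l, g). g # l) (?L \<times> \<G>) {l. set l \<subseteq> \<G> \<and> length l = Suc k}"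
    by (rule bij_betwI[where g = "\<lambda>l. (tl l, hd l)"]) (auto simp: length_Suc_conv)
  have "(\<Sum>l | set l \<subseteq> \<G> \<and> length l = Suc k. prod_list (map q l) * ?w l)
      = (\<Sum>(l, g)\<in>?L \<times> \<G>. prod_list (map q (g # l)) * ?w (g # l))"
    by (subst sum.reindex_bij_betw[OF bij, symmetric]) (simp add: case_prod_beta)
  also have "\<dots> = (\<Sum>l\<in>?L. prod_list (map q l) * (\<Sum>g\<in>\<G>. q g * ?w (g # l)))"
    unfolding sum.cartesian_product[symmetric] by (simp only: sum_distrib_left list.map prod_list.Cons mult_ac)
  also have "\<dots> \<le> (\<Sum>l\<in>?L. prod_list (map q l) * ((p + 2 * \<theta>) * ?w l))"
    by (intro sum_mono mult_left_mono window_weight_step prod_list_nonneg) (auto simp: q_nonneg)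
  also have "\<dots> = (p + 2 * \<theta>) * (\<Sum>l\<in>?L. prod_list (map q l) * ?w l)"
    by (simp only: sum_distrib_left mult_ac)
  also have "\<dots> \<le> (p + 2 * \<theta>) * (p + 2 * \<theta>) ^ k"
    using Suc p_nonneg \<theta> by (intro mult_left_mono) auto
  finally show ?case by simp
qed

text \<open>Markov's inequality: a sequence with at most \<open>m\<close> completed windows has
  weight at least the denominator.\<close>

lemma few_windows_sum_bound:
  "(\<Sum>l | set l \<subseteq> \<G> \<and> length l = k \<and> fst (windows l) \<le> m. prod_list (map q l))
    \<le> (p + 2 * \<theta>) ^ k / ((\<theta> ^ Suc (card \<G>)) ^ m * \<theta> ^ card \<G>)"
proof -
  let ?L = "{l. set l \<subseteq> \<G> \<and> length l = k}"
  let ?F = "{l. set l \<subseteq> \<G> \<and> length l = k \<and> fst (windows l) \<le> m}"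
  let ?w = "\<lambda>l. window_weight (card \<G>) \<theta> (windows l)"
  define b where "b = (\<theta> ^ Suc (card \<G>)) ^ m * \<theta> ^ card \<G>"
  have b: "0 < b" using \<theta> by (simp add: b_def)
  have finL: "finite ?L" by (rule finite_lists_length_eq[OF fin])
  have q: "0 \<le> prod_list (map q l)" for l
    by (intro prod_list_nonneg) (auto simp: q_nonneg)
  have "(\<Sum>l\<in>?F. prod_list (map q l)) * b \<le> (\<Sum>l\<in>?F. prod_list (map q l) * ?w l)"
    unfolding sum_distrib_right
  proof (intro sum_mono mult_left_mono q)
    fix l assume l: "l \<in> ?F"
    have "card (snd (windows l)) \<le> card \<G>"
      using windows_current[of l \<G>] l by (auto intro!: card_mono fin)
    moreover have "\<theta> ^ Suc (card \<G>) \<le> 1" using \<theta> by (intro power_le_one) auto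
    ultimately show "b \<le> ?w l"
      unfolding b_def window_weight_def using l \<theta>
      by (intro mult_mono power_decreasing) auto
  qed
  also have "\<dots> \<le> (\<Sum>l\<in>?L. prod_list (map q l) * ?w l)"
    using finL q \<theta> by (intro sum_mono2) (auto simp: window_weight_def)
  also have "\<dots> \<le> (p + 2 * \<theta>) ^ k" by (rule window_weight_bound)
  finally show ?thesis unfolding b_def[symmetric] using b by (simp add: pos_le_divide_eq)
qed

end

section \<open>Logarithmic limits from exponential bounds\<close>

lemma log_rate_tendsto:
  assumes p: "0 \<le> p"
    and lower: "\<And>k. k \<ge> 1 \<Longrightarrow> p ^ k \<le> P k"
    and upper: "\<And>r. r > p \<Longrightarrow> \<exists>C>0. \<forall>k. P k \<le> C * r ^ k"
  shows "(\<lambda>k. ereal (1 / real k) * ext_ln (P k)) \<longlonglongrightarrow> ext_ln p"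
proof (rule order_tendstoI)
  fix a assume a: "a < ext_ln p"
  then have "0 < p" by (auto simp: ext_ln_def split: if_splits)
  have "a < ereal (1 / real k) * ext_ln (P k)" if "k \<ge> 1" for k
  proof -
    have Pk: "0 < P k" using lower[OF that] \<open>0 < p\<close> by (auto intro: less_le_trans[of _ "p ^ k"])
    then have "ln (p ^ k) \<le> ln (P k)"
      using lower[OF that] \<open>0 < p\<close> by simp
    then have "ln p \<le> 1 / real k * ln (P k)"
      using that \<open>0 < p\<close> by (simp add: ln_realpow field_simps)
    moreover have "a < ereal (ln p)" using a \<open>0 < p\<close> by (simp add: ext_ln_def)
    ultimately show ?thesis using Pk
      by (auto simp: ext_ln_def intro: less_le_trans)
  qed
  then show "\<forall>\<^sub>F k in sequentially. a < ereal (1 / real k) * ext_ln (P k)"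
    by (auto simp: eventually_sequentially)
next
  fix a assume a: "ext_ln p < a"
  \<comment> \<open>Two real numbers are inserted: \<open>exp s\<close> serves as base of the
    exponential bound, also when \<open>p = 0\<close>, and the distance from \<open>s\<close> to
    \<open>r\<close> absorbs the vanishing term \<open>ln C / real k\<close>.\<close>
  obtain r where r: "ext_ln p < ereal r" "ereal r < a" using ereal_dense2[OF a] by blast
  obtain s where s: "ext_ln p < ereal s" "ereal s < ereal r" using ereal_dense2[OF r(1)] by blast
  have "p < exp s"
  proof (cases "p = 0")
    case False
    then have "0 < p" "ln p < s" using p s(1) by (auto simp: ext_ln_def)
    then show ?thesis by (metis exp_less_mono exp_ln)
  qed simp
  from upper[OF this] obtain C where C: "C > 0" "\<And>k. P k \<le> C * exp s ^ k" by blast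
  have "(\<lambda>k. ln C / real k + s) \<longlonglongrightarrow> 0 + s"
    by (intro tendsto_intros lim_const_over_n)
  then have "\<forall>\<^sub>F k in sequentially. ln C / real k + s < r"
    by (rule order_tendstoD) (use s(2) in simp)
  then show "\<forall>\<^sub>F k in sequentially. ereal (1 / real k) * ext_ln (P k) < a"
    using eventually_gt_at_top[of 0]
  proof eventually_elim
    case (elim k)
    show ?case
    proof (cases "P k \<le> 0")
      case True
      \<comment> \<open>For \<open>k > 0\<close> the factor \<open>1 / real k\<close> is positive,
        so the product is still minus infinity.\<close>
      have "- \<infinity> < a" using r(2) by (metis ereal_infty_less(2) less_ereal.simps(6) order_less_trans)
      then show ?thesis using True elim(2) by (simp add: ext_ln_def)
    next
      case False
      have "ln (P k) \<le> ln (C * exp s ^ k)"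
        using False C by (intro ln_mono) auto
      also have "\<dots> = ln C + real k * s" using C(1) by (simp add: ln_mult ln_realpow)
      finally have "1 / real k * ln (P k) \<le> ln C / real k + s"
        using elim(2) by (simp add: field_simps)
      then have "ereal (1 / real k * ln (P k)) < ereal r" using elim(1) by simp
      also note r(2)
      finally show ?thesis using False by (simp add: ext_ln_def)
    qed
  qed
qed


section \<open>Measurability\<close>

lemma borel_measurable_vec_nth2 [measurable]: "(\<lambda>A :: real^'n^'m. A $ i $ j) \<in> borel_measurable borel"
  by (intro borel_measurable_continuous_onI continuous_intros)

text \<open>The graph is a function of the set of positive entries, which ranges over a finite type;
  the preimage of each such set is a finite conjunction of measurable conditions on entries.\<close>

lemma measurable_induced_graph [measurable]:
  "(induced_graph :: real^'n^'n \<Rightarrow> 'n ugraph) \<in> borel \<rightarrow>\<^sub>M count_space UNIV"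
proof -
  let ?pos = "\<lambda>A :: real^'n^'n. {(i, j). A $ i $ j > 0}"
  have "?pos \<in> borel \<rightarrow>\<^sub>M count_space UNIV"
  proof (subst measurable_count_space_eq2[OF finite], intro conjI ballI)
    fix P :: "('n \<times> 'n) set"
    have "Measurable.pred borel (\<lambda>A :: real^'n^'n. \<forall>i j. (A $ i $ j > 0) = ((i, j) \<in> P))"
      by measurable
    then have "{A :: real^'n^'n. \<forall>i j. (A $ i $ j > 0) = ((i, j) \<in> P)} \<in> sets borel"
      by (simp add: pred_def)
    also have "{A :: real^'n^'n. \<forall>i j. (A $ i $ j > 0) = ((i, j) \<in> P)} = ?pos -` {P} \<inter> space borel"
      by auto
    finally show "?pos -` {P} \<inter> space borel \<in> sets borel" .
  qed auto
  then have "(\<lambda>A. (UNIV, {{i, j} | i j. i \<noteq> j \<and> (i, j) \<in> ?pos A})) \<in> borel \<rightarrow>\<^sub>M count_space UNIV"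
    by (rule measurable_compose[where g = "\<lambda>P. (UNIV, {{i, j} | i j. i \<noteq> j \<and> (i, j) \<in> P})"]) simp
  then show ?thesis by (simp add: induced_graph_def[abs_def])
qed

text \<open>The map from matrices to bounded linear operators is linear on a finite-dimensional
  space, hence continuous, and the operator norm is continuous.\<close>

lemma borel_measurable_spectral_norm [measurable]:
  "(spectral_norm :: real^'n^'n \<Rightarrow> real) \<in> borel_measurable borel"
proof -
  have app: "blinfun_apply (Blinfun (\<lambda>x. A *v x)) = (\<lambda>x. A *v x)" for A :: "real^'n^'n"
    by (rule bounded_linear_Blinfun_apply) (rule matrix_vector_mul_bounded_linear)
  have "linear (\<lambda>A :: real^'n^'n. Blinfun (\<lambda>x. A *v x))"
    by (intro linearI blinfun_eqI; simp only: app plus_blinfun.rep_eq scaleR_blinfun.rep_eq)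
      (simp_all add: matrix_vector_mult_add_rdistrib scaleR_matrix_vector_assoc)
  then have "continuous_on UNIV (\<lambda>A :: real^'n^'n. norm (Blinfun (\<lambda>x. A *v x)))"
    by (intro continuous_intros linear_continuous_on) (simp add: linear_conv_bounded_linear)
  moreover have "(\<lambda>A :: real^'n^'n. norm (Blinfun (\<lambda>x. A *v x))) = spectral_norm"
    by (simp add: fun_eq_iff spectral_norm_def norm_blinfun.rep_eq app)
  ultimately show ?thesis by (metis borel_measurable_continuous_onI)
qed

lemma borel_measurable_matrix_mult:
  fixes f :: "'a \<Rightarrow> real^'n^'m" and g :: "'a \<Rightarrow> real^'k^'n"
  assumes "f \<in> borel_measurable M" "g \<in> borel_measurable M"
  shows "(\<lambda>x. f x ** g x) \<in> borel_measurable M"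
proof (rule borel_measurable_continuous_Pair[OF assms])
  show "continuous_on UNIV (\<lambda>x :: (real^'n^'m) \<times> (real^'k^'n). fst x ** snd x)"
    unfolding matrix_matrix_mult_def by (intro continuous_intros)
qed


section \<open>The random process\<close>

locale weight_process = prob_space M
  for M :: "'a measure" +
  fixes W :: "nat \<Rightarrow> 'a \<Rightarrow> real^'n^'n" and \<delta> :: real
  assumes iid: "iid_matrices M W" and \<delta>: "0 < \<delta>"
    and admissible_W: "\<And>k \<omega>. k \<ge> 1 \<Longrightarrow> \<omega> \<in> space M \<Longrightarrow> admissible \<delta> (W k \<omega>)"
begin

lemma W_indep: "indep_vars (\<lambda>_. borel) W {1..}"
  using iid unfolding iid_matrices_def by (rule conjunct1)

lemma W_distr: "k \<ge> 1 \<Longrightarrow> distr M borel (W k) = distr M borel (W 1)"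
  using iid unfolding iid_matrices_def by blast

lemma W_measurable: "k \<ge> 1 \<Longrightarrow> W k \<in> borel_measurable M"
  using W_indep by (simp add: indep_vars_def)

lemma graph_process_measurable: "k \<ge> 1 \<Longrightarrow> graph_process W k \<in> M \<rightarrow>\<^sub>M count_space UNIV"
  unfolding graph_process_def[abs_def]
  by (rule measurable_compose[OF W_measurable measurable_induced_graph])

lemma graph_event_eq: "{\<omega> \<in> space M. graph_process W k \<omega> \<in> B} = graph_process W k -` B \<inter> space M"
  by blast

lemma graph_event: "k \<ge> 1 \<Longrightarrow> {\<omega> \<in> space M. graph_process W k \<omega> \<in> B} \<in> events"
  unfolding graph_event_eq by (rule measurable_sets[OF graph_process_measurable]) auto

lemma error_matrix_measurable: "error_matrix W k \<in> borel_measurable M"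
proof -
  have "(\<lambda>\<omega>. mat_prod (\<lambda>t. W t \<omega>) k) \<in> borel_measurable M"
    by (induction k) (auto intro!: borel_measurable_matrix_mult W_measurable)
  then show ?thesis unfolding error_matrix_def[abs_def] by simp
qed

lemma prob_graph_eq:
  assumes "k \<ge> 1"
  shows "prob {\<omega> \<in> space M. graph_process W k \<omega> \<in> B} = prob {\<omega> \<in> space M. graph_process W 1 \<omega> \<in> B}"
proof -
  have "prob {\<omega> \<in> space M. graph_process W t \<omega> \<in> B} = measure (distr M borel (W t)) (induced_graph -` B)"
    if "t \<ge> 1" for t
  proof -
    have "induced_graph -` B \<in> sets (borel :: (real^'n^'n) measure)"
      using measurable_sets[OF measurable_induced_graph, of B] by simp
    then show ?thesis
      by (subst measure_distr[OF W_measurable[OF that]])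
        (auto simp: graph_process_def intro!: arg_cong[where f = prob])
  qed
  from this[OF assms] this[of 1] show ?thesis by (simp only: W_distr[OF assms])
qed

lemma prob_graphs:
  "prob {\<omega> \<in> space M. \<forall>t\<in>{1..k}. graph_process W t \<omega> \<in> B t}
    = (\<Prod>t\<in>{1..k}. prob {\<omega> \<in> space M. graph_process W 1 \<omega> \<in> B t})"
\<comment> \<open>The product formula for independent events is applied to nonempty index sets only,
  and an empty intersection would be \<open>UNIV\<close> instead of \<open>space M\<close>.\<close>
proof (cases "k = 0")
  case True
  then show ?thesis by (simp add: prob_space)
next
  case False
  have ind: "indep_vars (\<lambda>_. count_space UNIV) (graph_process W) {1..}"
    unfolding graph_process_def[abs_def]
    by (rule indep_vars_compose2[OF W_indep]) simp
  have "prob {\<omega> \<in> space M. \<forall>t\<in>{1..k}. graph_process W t \<omega> \<in> B t}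
      = prob (\<Inter>t\<in>{1..k}. graph_process W t -` B t \<inter> space M)"
    using False by (intro arg_cong[where f = prob]) auto
  also have "\<dots> = (\<Prod>t\<in>{1..k}. prob (graph_process W t -` B t \<inter> space M))"
    using False by (intro indep_varsD[OF ind]) auto
  also have "\<dots> = (\<Prod>t\<in>{1..k}. prob {\<omega> \<in> space M. graph_process W 1 \<omega> \<in> B t})"
    unfolding graph_event_eq[symmetric] by (intro prod.cong prob_graph_eq) auto
  finally show ?thesis .
qed

lemma collection_prob_eq: "collection_prob M W H = prob {\<omega> \<in> space M. graph_process W 1 \<omega> \<in> H}"
proof -
  have "prob (\<Union>G\<in>H. {\<omega> \<in> space M. graph_process W 1 \<omega> = G}) = collection_prob M W H"
    unfolding collection_prob_def
  proof (rule finite_measure_finite_Union)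
    show "(\<lambda>G. {\<omega> \<in> space M. graph_process W 1 \<omega> = G}) ` H \<subseteq> sets M"
      using graph_event[of 1 "{G}" for G] by auto
  qed (auto simp: disjoint_family_on_def)
  moreover have "(\<Union>G\<in>H. {\<omega> \<in> space M. graph_process W 1 \<omega> = G}) = {\<omega> \<in> space M. graph_process W 1 \<omega> \<in> H}"
    by auto
  ultimately show ?thesis by simp
qed

section \<open>Graph paths and the largest disconnected mass\<close>

abbreviation "\<G> \<equiv> realizable_graphs M W"
abbreviation "q G \<equiv> prob {\<omega> \<in> space M. graph_process W 1 \<omega> = G}"

lemma graph_process_in_graphs: "k \<ge> 1 \<Longrightarrow> \<omega> \<in> space M \<Longrightarrow> graph_process W k \<omega> \<in> \<G>"
  by (auto simp: graph_process_def realizable_graphs_def realizations_def)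

lemma past_subset: "\<omega> \<in> space M \<Longrightarrow> set (past (\<lambda>t. graph_process W t \<omega>) k) \<subseteq> \<G>"
  unfolding set_past image_subset_iff using graph_process_in_graphs by simp

lemma prob_past:
  assumes "length l = k"
  shows "prob {\<omega> \<in> space M. past (\<lambda>t. graph_process W t \<omega>) k = l} = prod_list (map q l)"
proof -
  have "prob {\<omega> \<in> space M. past (\<lambda>t. graph_process W t \<omega>) k = l}
      = (\<Prod>t\<in>{1..k}. q (l ! (k - t)))"
    using prob_graphs[of k "\<lambda>t. {l ! (k - t)}"] by (simp add: past_eq_iff[OF assms])
  then show ?thesis by (simp only: prod_nth_rev[OF assms, of q])
qed

lemma past_event: "{\<omega> \<in> space M. past (\<lambda>t. graph_process W t \<omega>) k = l} \<in> events"
proof (cases "length l = k")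
  case True
  have "Measurable.pred M (\<lambda>\<omega>. graph_process W t \<omega> = l ! (k - t))" if "t \<in> {1..k}" for t
    using graph_event[of t "{l ! (k - t)}"] that by (simp add: pred_def)
  then have "Measurable.pred M (\<lambda>\<omega>. \<forall>t\<in>{1..k}. graph_process W t \<omega> = l ! (k - t))"
    by (intro pred_intros_finite) auto
  then show ?thesis by (simp add: past_eq_iff[OF True] pred_def)
next
  case False
  then have "{\<omega> \<in> space M. past (\<lambda>t. graph_process W t \<omega>) k = l} = {}" by auto
  then show ?thesis by (simp only: sets.empty_sets)
qed

text \<open>The value 0 for an empty set of maximal collections makes the negated rate equal to
  \<open>ext_ln mass\<close> in both cases.\<close>

definition mass :: real where
  "mass = (if max_disconnected_collections \<G> = {} then 0 else p_max M W)"

text \<open>Any disconnected collection lies in a maximal one, and the probability is monotone in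
  the collection.\<close>

lemma collection_prob_le_mass:
  assumes "H \<subseteq> \<G>" "\<not> connected_graph (supergraph H)" "H \<noteq> {}"
  shows "collection_prob M W H \<le> mass"
proof -
  obtain H' where H': "H' \<in> max_disconnected_collections \<G>" "H \<subseteq> H'"
    using disconnected_collection_extends[of \<G> H] assms by (auto simp: disconnected_collection_def)
  have "collection_prob M W H \<le> collection_prob M W H'"
    unfolding collection_prob_def by (intro sum_mono2 H') auto
  also have "\<dots> \<le> p_max M W"
    unfolding p_max_def by (intro Max_ge imageI H') auto
  finally show ?thesis using H'(1) by (auto simp: mass_def)
qed

lemma mass_attained:
  assumes "max_disconnected_collections \<G> \<noteq> {}"
  obtains H where "H \<in> max_disconnected_collections \<G>" "mass = collection_prob M W H"
proof -
  have "p_max M W \<in> collection_prob M W ` max_disconnected_collections \<G>"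
    unfolding p_max_def using assms by (intro Max_in) auto
  then show thesis using assms that by (auto simp: mass_def)
qed

lemma mass_bounds: "0 \<le> mass" "mass \<le> 1"
proof -
  have "0 \<le> mass \<and> mass \<le> 1"
  proof (cases "max_disconnected_collections \<G> = {}")
    case False
    then show ?thesis using mass_attained by (metis collection_prob_eq measure_nonneg prob_le_1)
  qed (simp add: mass_def)
  then show "0 \<le> mass" "mass \<le> 1" by auto
qed

text \<open>Since \<open>mass \<le> 1\<close>, the logarithm is at most 0 and equals the negative of
  its absolute value.\<close>

lemma uminus_rate: "- rate M W = ext_ln mass"
proof (cases "max_disconnected_collections \<G> = {}")
  case False
  have "ext_ln mass \<le> 0" using mass_bounds by (simp add: ext_ln_def)
  then have "- \<bar>ext_ln mass\<bar> = ext_ln mass" by (cases "ext_ln mass") auto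
  then show ?thesis using False by (simp add: rate_def mass_def)
qed (simp add: rate_def mass_def ext_ln_def)

section \<open>Exponential bounds for the error probability\<close>

lemma lower_bound:
  assumes "\<epsilon> \<le> 1" "k \<ge> 1"
  shows "mass ^ k \<le> prob {\<omega> \<in> space M. spectral_norm (error_matrix W k \<omega>) \<ge> \<epsilon>}"
proof (cases "max_disconnected_collections \<G> = {}")
  case True
  then show ?thesis using \<open>k \<ge> 1\<close> by (simp add: mass_def power_0_left)
next
  case False
  then obtain H where H: "H \<in> max_disconnected_collections \<G>" "mass = collection_prob M W H"
    by (rule mass_attained)
  \<comment> \<open>By independence this is the chance that all graphs up to time \<open>k\<close>
    stay in an optimal disconnected collection, where the error norm is at least 1.\<close>
  have "mass ^ k = prob {\<omega> \<in> space M. \<forall>t\<in>{1..k}. graph_process W t \<omega> \<in> H}"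
    using prob_graphs[of k "\<lambda>_. H"] by (simp add: H(2) collection_prob_eq)
  also have "\<dots> \<le> prob {\<omega> \<in> space M. spectral_norm (error_matrix W k \<omega>) \<ge> \<epsilon>}"
  proof (rule finite_measure_mono)
    show "{\<omega> \<in> space M. spectral_norm (error_matrix W k \<omega>) \<ge> \<epsilon>} \<in> events"
      using error_matrix_measurable by measurable
    show "{\<omega> \<in> space M. \<forall>t\<in>{1..k}. graph_process W t \<omega> \<in> H}
        \<subseteq> {\<omega> \<in> space M. spectral_norm (error_matrix W k \<omega>) \<ge> \<epsilon>}"
    proof safe
      fix \<omega> assume \<omega>: "\<omega> \<in> space M" "\<forall>t\<in>{1..k}. graph_process W t \<omega> \<in> H"
      have "1 \<le> spectral_norm (error_matrix W k \<omega>)"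
        unfolding error_matrix_def
      proof (rule spectral_norm_ge_1)
        show "\<not> connected_graph (supergraph H)"
          using H(1) by (simp add: max_disconnected_collections_def maximal_disconnected_collection_def
              disconnected_collection_def)
      qed (use \<omega> admissible_W in \<open>auto simp: admissible_def graph_process_def\<close>)
      then show "\<epsilon> \<le> spectral_norm (error_matrix W k \<omega>)" using \<open>\<epsilon> \<le> 1\<close> by linarith
    qed
  qed
  finally show ?thesis .
qed

text \<open>Keeps the contraction factor nonnegative.\<close>

lemma \<delta>_le_1: "\<delta> \<le> 1"
proof -
  obtain \<omega> where "\<omega> \<in> space M" using not_empty by blast
  then have adm: "admissible \<delta> (W 1 \<omega>)" by (intro admissible_W) auto
  then have "\<delta> \<le> W 1 \<omega> $ i $ i" for i by (simp add: admissible_def)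
  also have "W 1 \<omega> $ i $ i \<le> (\<Sum>j\<in>UNIV. W 1 \<omega> $ i $ j)" for i
    using adm by (intro member_le_sum) (auto simp: admissible_def doubly_stochastic_def)
  also have "(\<Sum>j\<in>UNIV. W 1 \<omega> $ i $ j) = 1" for i
    using adm by (simp add: admissible_def doubly_stochastic_def)
  finally show ?thesis by simp
qed

text \<open>The error norm is at most the square root of the contraction factor to the number of
  completed windows, so \<open>m\<close> with \<open>c ^ m < \<epsilon>\<^sup>2\<close> works for
  all \<open>k\<close> and all outcomes at once.\<close>

lemma large_error_imp_few_windows:
  assumes "\<epsilon> > 0"
  obtains m where "\<And>k \<omega>. \<omega> \<in> space M \<Longrightarrow> spectral_norm (error_matrix W k \<omega>) \<ge> \<epsilon> \<Longrightarrow>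
    fst (windows (past (\<lambda>t. graph_process W t \<omega>) k)) \<le> m"
proof -
  define c where "c = 1 - \<delta> / (2 * real CARD('n) ^ 3)"
  have "1 \<le> real CARD('n) ^ 3" by simp
  then have "\<delta> \<le> 2 * real CARD('n) ^ 3" using \<delta>_le_1 by linarith
  then have c: "0 \<le> c" "c < 1" using \<delta> by (auto simp: c_def)
  obtain m where m: "c ^ m < \<epsilon>\<^sup>2" using real_arch_pow_inv[of "\<epsilon>\<^sup>2" c] c assms by auto
  show thesis
  proof (rule that[of m], rule ccontr)
    fix k \<omega> assume \<omega>: "\<omega> \<in> space M" and ge: "\<epsilon> \<le> spectral_norm (error_matrix W k \<omega>)"
    let ?c = "fst (windows (past (\<lambda>t. graph_process W t \<omega>) k))"
    assume "\<not> ?c \<le> m"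
    then have "c ^ ?c \<le> c ^ m" using c by (intro power_decreasing) auto
    with m have "c ^ ?c < \<epsilon>\<^sup>2" by linarith
    have "spectral_norm (error_matrix W k \<omega>) \<le> sqrt (c ^ ?c)"
      unfolding error_matrix_def c_def graph_process_def
      by (rule spectral_norm_windows_bound[OF admissible_W[OF _ \<omega>] \<delta> \<delta>_le_1])
    also have "\<dots> < \<epsilon>"
      using real_sqrt_less_mono[OF \<open>c ^ ?c < \<epsilon>\<^sup>2\<close>] assms by simp
    finally show False using ge by simp
  qed
qed

text \<open>Union bound over the finitely many graph sequences of length \<open>k\<close> with at
  most \<open>m\<close> completed windows; \<open>m\<close> and \<open>\<theta>\<close>, and hence
  \<open>C\<close>, do not depend on \<open>k\<close>.\<close>

lemma upper_bound:
  assumes "\<epsilon> > 0" "r > mass"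
  shows "\<exists>C>0. \<forall>k. prob {\<omega> \<in> space M. spectral_norm (error_matrix W k \<omega>) \<ge> \<epsilon>} \<le> C * r ^ k"
proof -
  obtain m where m: "\<And>k \<omega>. \<omega> \<in> space M \<Longrightarrow> spectral_norm (error_matrix W k \<omega>) \<ge> \<epsilon> \<Longrightarrow>
      fst (windows (past (\<lambda>t. graph_process W t \<omega>) k)) \<le> m"
    using large_error_imp_few_windows[OF assms(1)] by blast
  \<comment> \<open>Chosen so that the growth factor \<open>mass + 2 * \<theta>\<close> is at most
    \<open>r\<close>; the cap 1 is required for the weights to decrease.\<close>
  define \<theta> where "\<theta> = min 1 ((r - mass) / 2)"
  have \<theta>: "0 < \<theta>" "\<theta> \<le> 1" "mass + 2 * \<theta> \<le> r" using assms(2) by (auto simp: \<theta>_def min_def field_simps)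
  define C where "C = 1 / ((\<theta> ^ Suc (card \<G>)) ^ m * \<theta> ^ card \<G>)"
  have C: "0 < C" unfolding C_def using \<theta> by simp
  have "prob {\<omega> \<in> space M. spectral_norm (error_matrix W k \<omega>) \<ge> \<epsilon>} \<le> C * r ^ k" for k
  proof -
    let ?F = "{l. set l \<subseteq> \<G> \<and> length l = k \<and> fst (windows l) \<le> m}"
    have fin: "finite ?F"
      by (rule finite_subset[OF _ finite_lists_length_eq[of \<G> k]]) auto
    have "prob {\<omega> \<in> space M. spectral_norm (error_matrix W k \<omega>) \<ge> \<epsilon>}
        \<le> prob (\<Union>l\<in>?F. {\<omega> \<in> space M. past (\<lambda>t. graph_process W t \<omega>) k = l})"
      using m past_subset by (intro finite_measure_mono sets.finite_UN fin past_event) auto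
    also have "\<dots> \<le> (\<Sum>l\<in>?F. prob {\<omega> \<in> space M. past (\<lambda>t. graph_process W t \<omega>) k = l})"
      using fin past_event by (intro finite_measure_subadditive_finite) auto
    also have "\<dots> = (\<Sum>l\<in>?F. prod_list (map q l))"
      by (intro sum.cong prob_past) auto
    also have "\<dots> \<le> (mass + 2 * \<theta>) ^ k / ((\<theta> ^ Suc (card \<G>)) ^ m * \<theta> ^ card \<G>)"
    proof (rule few_windows_sum_bound)
      show "sum q \<G> \<le> 1"
        using collection_prob_eq[of \<G>] by (simp add: collection_prob_def)
      show "sum q H \<le> mass" if "H \<subseteq> \<G>" "\<not> connected_graph (supergraph H)" "H \<noteq> {}" for H
        using collection_prob_le_mass[OF that] by (simp add: collection_prob_def)
    qed (use \<theta> mass_bounds in auto)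
    also have "\<dots> = C * (mass + 2 * \<theta>) ^ k" by (simp add: C_def)
    also have "\<dots> \<le> C * r ^ k"
      using C \<theta> mass_bounds by (intro mult_left_mono power_mono) auto
    finally show ?thesis .
  qed
  with C show ?thesis by blast
qed

end

theorem theorem9:
  fixes M :: "'a measure"
    and W :: "nat \<Rightarrow> 'a \<Rightarrow> real^'n^'n"
    and \<delta> :: real
  assumes "prob_space M"
    and "\<And>A. A \<in> realizations M W \<Longrightarrow> symmetric_matrix A \<and> doubly_stochastic A"
    and "iid_matrices M W"
    and "\<delta> > 0"
    and "\<And>A i j. A \<in> realizations M W \<Longrightarrow> A $ i $ j > 0 \<Longrightarrow> A $ i $ j \<ge> \<delta>"
    and "\<And>A i. A \<in> realizations M W \<Longrightarrow> A $ i $ i \<ge> \<delta>"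
  shows "\<forall>\<epsilon>\<in>{0<..1}.
           (\<lambda>k. ereal (1 / real k) *
                ext_ln (measure M {\<omega> \<in> space M. spectral_norm (error_matrix W k \<omega>) \<ge> \<epsilon>}))
           \<longlonglongrightarrow> - rate M W"
proof -
  interpret prob_space M by fact
  have "W k \<omega> \<in> realizations M W" if "k \<ge> 1" "\<omega> \<in> space M" for k \<omega>
    using that by (auto simp: realizations_def)
  then interpret weight_process M W \<delta>
    using assms by unfold_locales (auto simp: admissible_def)
  show ?thesis
    \<comment> \<open>The limit is now that of \<open>log_rate_tendsto\<close> for
      \<open>p = mass\<close>; the lower bound uses \<open>\<epsilon> \<le> 1\<close> and the upper
      bound \<open>\<epsilon> > 0\<close>.\<close>
    unfolding uminus_rate
    by (auto intro!: log_rate_tendsto mass_bounds lower_bound upper_bound)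
qed

end
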